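(* Assume $\mathsf{AD}^{\mathsf{L}}$. For every $A\subseteq\omega^\omega$, $A$ is selfcontractible if and only if $A$ is $\mathsf{L}$-nonselfdual.
   Context: Base theory: $\mathsf{ZF}+\mathsf{DC}(\mathbb{R})$. $\omega^\omega$ is the Baire space with the standard metric $d(x,y)=0$ if $x=y$ and $d(x,y)=2^{-n}$ if $x\neq y$ and $n$ is least with $x(n)\neq y(n)$. A function $f:\omega^\omega\to\omega^\omega$ is a contraction if there is a constant $0\leq L<1$ with $d(f(x),f(y))\leq L\cdot d(x,y)$ for all $x,y$, and is nonexpansive if $d(f(x),f(y))\leq d(x,y)$ for all $x,y$. $\mathsf{L}$ is the set of nonexpansive functions. $A\leq_{\mathsf{L}}B$ iff $A=f^{-1}(B)$ for some $f\in\mathsf{L}$. $A$ is $\mathsf{L}$-nonselfdual if $A\nleq_{\mathsf{L}}\omega^\omega\setminus A$. A set $A\subseteq\omega^\omega$ is selfcontractible if there is a contraction $f:\omega^\omega\to\omega^\omega$ with $f^{-1}(A)=A$. Lipschitz game $G_{\mathsf{L}}(A,B)$ for $A,B\subseteq\omega^\omega$: players I and II alternately play natural numbers (I first), I producing $a\in\omega^\omega$ and II producing $b\in\omega^\omega$ after $\omega$ many rounds; II wins iff ($a\in A\iff b\in B$). The axiom $\mathsf{AD}^{\mathsf{L}}$ states that for all $A,B\subseteq\omega^\omega$ the game $G_{\mathsf{L}}(A,B)$ is determined (one of the two players has a winning strategy). *)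

theory Defs
  imports Complex_Main
begin

type_synonym baire = "nat \<Rightarrow> nat"

(* The metric_space instance that HOL-Analysis.Function_Metric puts on function types
   is a different metric, so the standard Baire metric is defined here. *)
definition baire_dist :: "baire \<Rightarrow> baire \<Rightarrow> real" where
  "baire_dist x y = (if x = y then 0 else 1 / 2 ^ (LEAST n. x n \<noteq> y n))"

definition contraction :: "(baire \<Rightarrow> baire) \<Rightarrow> bool" where
  "contraction f \<longleftrightarrow>
     (\<exists>L::real. 0 \<le> L \<and> L < 1 \<and> (\<forall>x y. baire_dist (f x) (f y) \<le> L * baire_dist x y))"

definition nonexpansive :: "(baire \<Rightarrow> baire) \<Rightarrow> bool" where
  "nonexpansive f \<longleftrightarrow> (\<forall>x y. baire_dist (f x) (f y) \<le> baire_dist x y)"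

definition L_reducible :: "baire set \<Rightarrow> baire set \<Rightarrow> bool"  (infix "\<le>\<^sub>L" 50) where
  "A \<le>\<^sub>L B \<longleftrightarrow> (\<exists>f. nonexpansive f \<and> A = f -` B)"

definition L_nonselfdual :: "baire set \<Rightarrow> bool" where
  "L_nonselfdual A \<longleftrightarrow> \<not> A \<le>\<^sub>L (- A)"

definition selfcontractible :: "baire set \<Rightarrow> bool" where
  "selfcontractible A \<longleftrightarrow> (\<exists>f. contraction f \<and> f -` A = A)"

(* A play is the interleaved sequence z = (a 0, b 0, a 1, b 1, ...).  A strategy maps the
   finite sequence of all moves made so far to the next move. *)
type_synonym strategy = "nat list \<Rightarrow> nat"

definition moves_I :: "(nat \<Rightarrow> nat) \<Rightarrow> baire" where
  "moves_I z = (\<lambda>n. z (2 * n))"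

definition moves_II :: "(nat \<Rightarrow> nat) \<Rightarrow> baire" where
  "moves_II z = (\<lambda>n. z (2 * n + 1))"

definition follows_I :: "strategy \<Rightarrow> (nat \<Rightarrow> nat) \<Rightarrow> bool" where
  "follows_I \<sigma> z \<longleftrightarrow> (\<forall>n. z (2 * n) = \<sigma> (map z [0..<2 * n]))"

definition follows_II :: "strategy \<Rightarrow> (nat \<Rightarrow> nat) \<Rightarrow> bool" where
  "follows_II \<tau> z \<longleftrightarrow> (\<forall>n. z (2 * n + 1) = \<tau> (map z [0..<2 * n + 1]))"

definition II_wins_play :: "baire set \<Rightarrow> baire set \<Rightarrow> (nat \<Rightarrow> nat) \<Rightarrow> bool" where
  "II_wins_play A B z \<longleftrightarrow> (moves_I z \<in> A \<longleftrightarrow> moves_II z \<in> B)"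

definition winning_I :: "baire set \<Rightarrow> baire set \<Rightarrow> strategy \<Rightarrow> bool" where
  "winning_I A B \<sigma> \<longleftrightarrow> (\<forall>z. follows_I \<sigma> z \<longrightarrow> \<not> II_wins_play A B z)"

definition winning_II :: "baire set \<Rightarrow> baire set \<Rightarrow> strategy \<Rightarrow> bool" where
  "winning_II A B \<tau> \<longleftrightarrow> (\<forall>z. follows_II \<tau> z \<longrightarrow> II_wins_play A B z)"

definition L_determined :: "baire set \<Rightarrow> baire set \<Rightarrow> bool" where
  "L_determined A B \<longleftrightarrow> (\<exists>\<sigma>. winning_I A B \<sigma>) \<or> (\<exists>\<tau>. winning_II A B \<tau>)"

(* AD_L UNIV is the axiom itself.  It contradicts the axiom of choice, hence is refutable in
   HOL, whereas the intended base theory is ZF + DC(R).  The axiom is therefore relativised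
   to a family P, read as the sets of reals of a choiceless universe: for instance, for an
   inner model M of ZF + DC(R) that contains all reals, the sets of reals lying in M. Strategies
   and nonexpansive functions are coded by reals, so such an M has all of them. *)
definition AD_L :: "baire set set \<Rightarrow> bool" where
  "AD_L P \<longleftrightarrow> (\<forall>A\<in>P. \<forall>B\<in>P. L_determined A B)"

end

theory Submission imports Defs begin

text \<open>
  If \<open>A\<close> is nonselfdual then II has no winning strategy in \<open>G\<^sub>L(A, - A)\<close>, so I has one.
  Since I moves first, the \<open>n\<close>-th move of I depends only on the moves of II before stage \<open>n\<close>;
  hence the strategy is a contraction, and its winning condition says that it reduces \<open>A\<close> to
  itself. Conversely, if \<open>f\<close> is a contraction reducing \<open>A\<close> to itself and \<open>g\<close> is a nonexpansive
  map reducing \<open>A\<close> to \<open>- A\<close>, then the contraction \<open>f \<circ> g\<close> has a fixed point \<open>x\<close>, and \<open>x \<in> A\<close>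
  iff \<open>x \<notin> A\<close>. This direction needs no determinacy.
\<close>

definition agree :: "nat \<Rightarrow> baire \<Rightarrow> baire \<Rightarrow> bool" where
  "agree n x y \<longleftrightarrow> (\<forall>k<n. x k = y k)"

text \<open>For distinct points both sides say that the first difference occurs at position
  \<open>n\<close> or later.\<close>

lemma baire_dist_le_iff: "baire_dist x y \<le> 1 / 2 ^ n \<longleftrightarrow> agree n x y"
proof (cases "x = y")
  case True
  then show ?thesis by (simp add: baire_dist_def agree_def)
next
  case False
  define m where "m = (LEAST n. x n \<noteq> y n)"
  have "\<exists>n. x n \<noteq> y n" using False by auto
  then have neq: "x m \<noteq> y m" unfolding m_def by (rule LeastI_ex)
  have eq: "x k = y k" if "k < m" for k
    using not_less_Least[of k "\<lambda>n. x n \<noteq> y n"] that unfolding m_def by blast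
  have "baire_dist x y \<le> 1 / 2 ^ n \<longleftrightarrow> n \<le> m"
    using False by (simp add: baire_dist_def m_def field_simps)
  also have "\<dots> \<longleftrightarrow> agree n x y"
    unfolding agree_def using neq eq by (meson leI le_less_trans less_le_trans)
  finally show ?thesis .
qed

lemma baire_dist_cases:
  obtains "x = y" "baire_dist x y = 0"
  | n where "baire_dist x y = 1 / 2 ^ n" "agree n x y"
proof (cases "x = y")
  case True
  then show ?thesis using that(1) by (simp add: baire_dist_def)
next
  case False
  then have "baire_dist x y = 1 / 2 ^ (LEAST n. x n \<noteq> y n)" by (simp add: baire_dist_def)
  then show ?thesis using that(2) baire_dist_le_iff by (metis order_refl)
qed

lemma nonexpansive_iff_agree:
  "nonexpansive f \<longleftrightarrow> (\<forall>n x y. agree n x y \<longrightarrow> agree n (f x) (f y))"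
proof
  assume "nonexpansive f"
  then show "\<forall>n x y. agree n x y \<longrightarrow> agree n (f x) (f y)"
    unfolding nonexpansive_def baire_dist_le_iff[symmetric] by (meson order_trans)
next
  assume *: "\<forall>n x y. agree n x y \<longrightarrow> agree n (f x) (f y)"
  show "nonexpansive f"
    unfolding nonexpansive_def
  proof (intro allI)
    fix x y
    show "baire_dist (f x) (f y) \<le> baire_dist x y"
    proof (cases rule: baire_dist_cases[of x y])
      case 1
      then show ?thesis by (simp add: baire_dist_def)
    next
      case (2 n)
      then show ?thesis using * by (simp add: baire_dist_le_iff)
    qed
  qed
qed

text \<open>Nonzero distances are powers of 1/2, so a factor \<open>L\<close> below 1 forces the
  exponent up by at least one. Conversely, gaining one digit gives the constant 1/2.\<close>

lemma contraction_iff_agree: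
  "contraction f \<longleftrightarrow> (\<forall>n x y. agree n x y \<longrightarrow> agree (Suc n) (f x) (f y))"
proof
  assume "contraction f"
  then obtain L :: real where L: "0 \<le> L" "L < 1"
    "\<And>x y. baire_dist (f x) (f y) \<le> L * baire_dist x y"
    unfolding contraction_def by blast
  show "\<forall>n x y. agree n x y \<longrightarrow> agree (Suc n) (f x) (f y)"
  proof (intro allI impI)
    fix n x y
    assume "agree n x y"
    then have "baire_dist x y \<le> 1 / 2 ^ n" by (simp add: baire_dist_le_iff)
    then have "baire_dist (f x) (f y) \<le> L * (1 / 2 ^ n)"
      using L(1) L(3)[of x y] by (meson mult_left_mono order_trans)
    also have "\<dots> < 1 / 2 ^ n" using L(2) by (simp add: divide_simps)
    finally have less: "baire_dist (f x) (f y) < 1 / 2 ^ n" .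
    show "agree (Suc n) (f x) (f y)"
    proof (cases rule: baire_dist_cases[of "f x" "f y"])
      case 1
      then show ?thesis by (simp add: agree_def)
    next
      case (2 m)
      have "(1 :: real) / 2 ^ m < 1 / 2 ^ n" using less unfolding 2(1) .
      then have "n < m" by (simp add: divide_simps)
      then show ?thesis using 2(2) by (simp add: agree_def)
    qed
  qed
next
  assume *: "\<forall>n x y. agree n x y \<longrightarrow> agree (Suc n) (f x) (f y)"
  have "baire_dist (f x) (f y) \<le> 1 / 2 * baire_dist x y" for x y
  proof (cases rule: baire_dist_cases[of x y])
    case 1
    then show ?thesis by (simp add: baire_dist_def)
  next
    case (2 n)
    then have "baire_dist (f x) (f y) \<le> 1 / 2 ^ Suc n"
      using * baire_dist_le_iff by blast
    then show ?thesis using 2(1) by simp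
  qed
  then show "contraction f"
    unfolding contraction_def by (intro exI[of _ "1 / 2 :: real"]) auto
qed

lemma contraction_comp_nonexpansive:
  assumes "contraction f" and "nonexpansive g"
  shows "contraction (f \<circ> g)"
  using assms by (simp add: contraction_iff_agree nonexpansive_iff_agree)

text \<open>Banach's argument done digit by digit: each application of \<open>h\<close> settles one
  more digit of the iterates.\<close>

lemma contraction_fixed_point:
  assumes "contraction h"
  obtains x where "h x = x"
proof
  have step: "agree (Suc n) (h x) (h y)" if "agree n x y" for n x y
    using assms that by (simp add: contraction_iff_agree)
  define u where "u n = (h ^^ n) (\<lambda>_. 0)" for n
  \<comment> \<open>\<open>u n\<close> has settled only the digits below \<open>n\<close>, so digit
    \<open>n\<close> is read off from \<open>u (Suc n)\<close>.\<close>
  define x where "x n = u (Suc n) n" for n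
  have u: "agree n (u n) (u (n + m))" for n m
    by (induction n) (auto simp: u_def agree_def[of 0] intro: step)
  have x: "agree n x (u n)" for n
    unfolding agree_def x_def
  proof (intro allI impI)
    fix k assume "k < n"
    then show "u (Suc k) k = u n k"
      using u[of "Suc k" "n - Suc k"] by (simp add: agree_def)
  qed
  show "h x = x"
  proof
    fix n
    \<comment> \<open>Agreement of \<open>x\<close> with \<open>u n\<close> below \<open>n\<close>
      becomes, after \<open>h\<close>, agreement of \<open>h x\<close> with \<open>u (Suc n)\<close>
      up to and including \<open>n\<close>.\<close>
    have "h x n = u (Suc n) n" using step[OF x[of n]] by (simp add: agree_def u_def)
    then show "h x n = x n" by (simp add: x_def)
  qed
qed

text \<open>Here \<open>s\<close> makes the moves of both players, so a strategy combined with a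
  fixed opponent generates a single play.\<close>

primrec history :: "strategy \<Rightarrow> nat \<Rightarrow> nat list" where
  "history s 0 = []"
| "history s (Suc n) = history s n @ [s (history s n)]"

definition run :: "strategy \<Rightarrow> nat \<Rightarrow> nat" where
  "run s n = s (history s n)"

lemma map_run: "map (run s) [0..<n] = history s n"
  by (induction n) (simp_all add: run_def)

lemma length_history [simp]: "length (history s n) = n"
  by (induction n) simp_all

text \<open>Move \<open>k\<close> depends on the strategy only through its values on histories of
  length at most \<open>k\<close>.\<close>

lemma run_cong:
  assumes "\<And>h. length h < n \<Longrightarrow> s h = t h" and "k < n"
  shows "run s k = run t k"
proof -
  have "history s m = history t m" if "m \<le> n" for m
    using that by (induction m) (auto simp: assms(1))
  then show ?thesis using assms by (simp add: run_def)
qed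

text \<open>The parity of the length tells whose turn it is, and half of it, rounded down, is the
  current round.\<close>

definition against_II :: "strategy \<Rightarrow> baire \<Rightarrow> strategy" where
  "against_II \<sigma> b h = (if even (length h) then \<sigma> h else b (length h div 2))"

definition against_I :: "strategy \<Rightarrow> baire \<Rightarrow> strategy" where
  "against_I \<tau> a h = (if even (length h) then a (length h div 2) else \<tau> h)"

lemma follows_I_run: "follows_I \<sigma> (run (against_II \<sigma> b))"
  unfolding follows_I_def map_run by (simp add: run_def against_II_def)

lemma moves_II_run: "moves_II (run (against_II \<sigma> b)) = b"
  by (auto simp: moves_II_def run_def against_II_def)

lemma follows_II_run: "follows_II \<tau> (run (against_I \<tau> a))"
  unfolding follows_II_def map_run by (simp add: run_def against_I_def)

lemma moves_I_run: "moves_I (run (against_I \<tau> a)) = a"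
  by (auto simp: moves_I_def run_def against_I_def)

text \<open>Move \<open>n\<close> of I stands at position \<open>2 * n\<close>, before
  \<open>b n\<close> is played, so \<open>n\<close> digits of \<open>b\<close> determine
  \<open>n + 1\<close> moves of I.\<close>

lemma contraction_strategy: "contraction (\<lambda>b. moves_I (run (against_II \<sigma> b)))"
  unfolding contraction_iff_agree
proof (intro allI impI)
  fix n b c
  assume "agree n b c"
  \<comment> \<open>An odd length below \<open>2 * n + 1\<close> is at most
    \<open>2 * n - 1\<close>, so only digits of \<open>b\<close> below \<open>n\<close> are
    consulted.\<close>
  then have "against_II \<sigma> b h = against_II \<sigma> c h" if "length h < 2 * n + 1" for h
    using that by (auto simp: against_II_def agree_def elim!: oddE)
  then have "run (against_II \<sigma> b) k = run (against_II \<sigma> c) k" if "k < 2 * n + 1" for k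
    using run_cong that by blast
  then show "agree (Suc n) (moves_I (run (against_II \<sigma> b))) (moves_I (run (against_II \<sigma> c)))"
    by (simp add: agree_def moves_I_def)
qed

text \<open>Move \<open>n\<close> of II comes after \<open>a n\<close>, so here no digit is
  gained.\<close>

lemma nonexpansive_strategy: "nonexpansive (\<lambda>a. moves_II (run (against_I \<tau> a)))"
  unfolding nonexpansive_iff_agree
proof (intro allI impI)
  fix n a c
  assume "agree n a c"
  then have "against_I \<tau> a h = against_I \<tau> c h" if "length h < 2 * n" for h
    using that by (auto simp: against_I_def agree_def elim!: evenE)
  then have "run (against_I \<tau> a) k = run (against_I \<tau> c) k" if "k < 2 * n" for k
    using run_cong that by blast
  then show "agree n (moves_II (run (against_I \<tau> a))) (moves_II (run (against_I \<tau> c)))"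
    by (simp add: agree_def moves_II_def)
qed

text \<open>The map sends the moves of II to the answers of I. For \<open>B = - A\<close> it reduces
  \<open>A\<close> to itself.\<close>

lemma winning_I_contraction:
  assumes "winning_I A B \<sigma>"
  obtains f where "contraction f" and "f -` A = - B"
proof
  show "contraction (\<lambda>b. moves_I (run (against_II \<sigma> b)))"
    by (rule contraction_strategy)
  show "(\<lambda>b. moves_I (run (against_II \<sigma> b))) -` A = - B"
    using assms follows_I_run moves_II_run
    unfolding winning_I_def II_wins_play_def by fastforce
qed

lemma winning_II_reducible:
  assumes "winning_II A B \<tau>"
  shows "A \<le>\<^sub>L B"
  unfolding L_reducible_def
proof (intro exI conjI)
  show "nonexpansive (\<lambda>a. moves_II (run (against_I \<tau> a)))"
    by (rule nonexpansive_strategy)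
  show "A = (\<lambda>a. moves_II (run (against_I \<tau> a))) -` B"
    using assms follows_II_run moves_I_run
    unfolding winning_II_def II_wins_play_def by fastforce
qed

lemma selfcontractible_imp_nonselfdual:
  assumes "selfcontractible A"
  shows "L_nonselfdual A"
  unfolding L_nonselfdual_def
proof
  assume "A \<le>\<^sub>L - A"
  then obtain g where g: "nonexpansive g" "A = g -` (- A)"
    unfolding L_reducible_def by blast
  obtain f where f: "contraction f" "f -` A = A"
    using assms unfolding selfcontractible_def by blast
  obtain x where "(f \<circ> g) x = x"
    using contraction_fixed_point contraction_comp_nonexpansive[OF f(1) g(1)] by blast
  then have "x \<in> A \<longleftrightarrow> g x \<in> A" using f(2) by (metis comp_apply vimage_eq)
  moreover have "x \<in> A \<longleftrightarrow> g x \<notin> A" using g(2) by blast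
  ultimately show False by blast
qed

lemma nonselfdual_imp_selfcontractible:
  assumes "L_determined A (- A)" and "L_nonselfdual A"
  shows "selfcontractible A"
proof -
  obtain \<sigma> where "winning_I A (- A) \<sigma>"
    using assms winning_II_reducible unfolding L_determined_def L_nonselfdual_def by blast
  then show ?thesis
    unfolding selfcontractible_def by (metis winning_I_contraction double_complement)
qed

text \<open>Closure of \<open>P\<close> under complements lets \<open>AD_L P\<close> apply to the
  game on \<open>A\<close> and \<open>- A\<close>, whose determinacy turns nonselfduality into a
  winning strategy for I.\<close>

theorem corollary4p4:
  fixes P :: "baire set set"
  assumes "\<forall>A\<in>P. - A \<in> P"
    and "AD_L P"
  shows "\<forall>A\<in>P. selfcontractible A \<longleftrightarrow> L_nonselfdual A"
  using assms selfcontractible_imp_nonselfdual nonselfdual_imp_selfcontractible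
  unfolding AD_L_def by blast

end
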